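(* Let $\mathbb{F}_q$ be the finite field with $q$ elements, let $m$ be a positive integer, and let $r\in\mathbb{F}_q^{\times}$. Suppose that $\mathbb{F}_q$ contains a primitive $m$-th root of unity, and let $t$ be the smallest positive integer such that $\mathrm{ord}(r)\,m\mid q^t-1$. Then the ring $\mathbb{F}_q[\sqrt[m]{r}]$ is isomorphic to $\mathbb{F}_{q^t}^{\,m/t}$, the product ring of $\frac{m}{t}$ copies of the field $\mathbb{F}_{q^t}$.
   Context: For $r\in\mathbb{F}_q^{\times}$, $\mathrm{ord}(r)$ denotes the multiplicative order of $r$. A primitive $m$-th root of unity in $\mathbb{F}_q$ is an element of $\mathbb{F}_q^{\times}$ of multiplicative order exactly $m$. The ring $\mathbb{F}_q[\sqrt[m]{r}]$ is the set of formal expressions $x_0+x_1\sqrt[m]{r}+\cdots+x_{m-1}(\sqrt[m]{r})^{m-1}$ with $x_i\in\mathbb{F}_q$, with coefficientwise addition and multiplication determined by $(\sqrt[m]{r})^m=r$; it is the commutative ring naturally isomorphic to $\mathbb{F}_q[x]/\langle x^m-r\rangle$ (with $\sqrt[m]{r}$ corresponding to the class of $x$). *)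

theory Defs
  imports "HOL-Algebra.Multiplicative_Group" "HOL-Algebra.Chinese_Remainder"
begin

(* The ring R[s] with s^m = r.  The coefficient tuple x stands for x 0 + x 1 * s + ... +
   x (m - 1) * s^(m - 1); products are reduced by s^(i + j) = r^((i + j) div m) * s^((i + j) mod m). *)
definition radical_extension :: "('a, 'c) ring_scheme \<Rightarrow> nat \<Rightarrow> 'a \<Rightarrow> (nat \<Rightarrow> 'a) ring" where
  "radical_extension R m r =
    \<lparr> carrier = {..<m} \<rightarrow>\<^sub>E carrier R,
      monoid.mult = (\<lambda>x y. \<lambda>k\<in>{..<m}.
        finsum R (\<lambda>(i, j). x i \<otimes>\<^bsub>R\<^esub> y j \<otimes>\<^bsub>R\<^esub> r [^]\<^bsub>R\<^esub> ((i + j) div m))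
          {(i, j). i < m \<and> j < m \<and> (i + j) mod m = k}),
      one = (\<lambda>k\<in>{..<m}. if k = 0 then \<one>\<^bsub>R\<^esub> else \<zero>\<^bsub>R\<^esub>),
      zero = (\<lambda>k\<in>{..<m}. \<zero>\<^bsub>R\<^esub>),
      add = (\<lambda>x y. \<lambda>k\<in>{..<m}. x k \<oplus>\<^bsub>R\<^esub> y k) \<rparr>"

end

theory Submission
  imports "HOL-Computational_Algebra.Polynomial" "HOL-Algebra.Sylow" Defs
begin

text \<open>Put \<open>\<eta> = r ^ ((q - 1) / m)\<close>. Since \<open>\<eta>\<close> is fixed by the \<open>q\<close>-th power map,
  \<open>r\<close> raised to \<open>(q\<^sup>s - 1) / m\<close> equals \<open>\<eta>\<^sup>s\<close>, so \<open>ord(r) m\<close> divides \<open>q\<^sup>s - 1\<close> iff \<open>\<eta>\<^sup>s = 1\<close>;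
  hence \<open>t = ord(\<eta>)\<close>, which divides \<open>m\<close>. Embed \<open>F\<close> into \<open>K\<close>; the divisibility for \<open>s = t\<close> gives an
  \<open>m\<close>-th root \<open>\<beta>\<close> of \<open>r\<close> in the cyclic group of units of \<open>K\<close>. Frobenius multiplies every such root
  by \<open>\<eta>\<close>, so with a primitive \<open>m\<close>-th root of unity \<open>\<zeta>\<close> the elements \<open>\<beta> \<zeta>\<^sup>i\<close>, \<open>i < m / t\<close>, represent
  the Frobenius orbits on the \<open>m\<close> roots. Evaluation at these representatives is a ring homomorphism
  to \<open>K\<close> to the power \<open>m / t\<close>. An element of its kernel is a polynomial of degree less than \<open>m\<close>
  vanishing at all \<open>m\<close> roots, so the map is injective, and both sides have \<open>q\<^sup>m\<close> elements.\<close>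

no_notation ideal_prod (infixl "\<cdot>\<index>" 80)

section \<open>Root counting over a finite domain\<close>

text \<open>A nonzero coefficient would make the sequence, cut off at \<open>n\<close>, a nonzero
  polynomial of degree below \<open>n\<close>; \<open>roots_bound\<close> grants it at most
  \<open>deg\<close> roots, fewer than \<open>S\<close> supplies.\<close>

lemma (in domain) many_roots_imp_coeffs_zero:
  assumes fin: "finite (carrier R)" and c: "c \<in> {..<n} \<rightarrow> carrier R"
    and S: "S \<subseteq> carrier R" "n \<le> card S"
    and roots: "\<And>x. x \<in> S \<Longrightarrow> (\<Oplus>i\<in>{..<n}. c i \<otimes> x [^] i) = \<zero>"
    and i: "i < n"
  shows "c i = \<zero>"
proof (rule ccontr)
  assume nz: "c i \<noteq> \<zero>"
  \<comment> \<open>Evaluation in \<open>UP R\<close> sums only up to the degree; vanishing higher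
    coefficients let the sum run up to \<open>n\<close>.\<close>
  have extend: "(\<Oplus>j\<in>{..k}. b j \<otimes> x [^] j) = (\<Oplus>j\<in>{..<n}. c j \<otimes> x [^] j)"
    if "k < n" "\<And>j. j \<le> k \<Longrightarrow> b j = c j" "\<And>j. k < j \<Longrightarrow> j < n \<Longrightarrow> c j = \<zero>" "x \<in> carrier R" for b k x
    by (rule add.finprod_mono_neutral_cong_left) (use that c in auto)
  interpret UP_domain R "UP R" by unfold_locales
  define p where "p = (\<lambda>j. if j < n then c j else \<zero>)"
  have pP: "p \<in> carrier (UP R)"
    using c by (auto simp: UP_def p_def up_def bound_def Pi_def intro!: exI[of _ n])
  have cp: "UnivPoly.coeff (UP R) p j = p j" for j
    using pP by (simp add: UP_def)
  have p0: "p \<noteq> \<zero>\<^bsub>UP R\<^esub>"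
    using nz i by (auto simp: UP_def p_def fun_eq_iff)
  have deg: "deg R p < n"
  proof -
    have "deg R p \<le> n - 1"
      by (rule deg_aboveI) (use pP i in \<open>auto simp: cp, auto simp: p_def\<close>)
    then show ?thesis using i by simp
  qed
  have high: "c j = \<zero>" if "deg R p < j" "j < n" for j
    using deg_aboveD[OF that(1) pP] that by (simp add: cp, simp add: p_def)
  have ev: "eval R R id x p = (\<Oplus>j\<in>{..<n}. c j \<otimes> x [^] j)" if x: "x \<in> carrier R" for x
  proof -
    have "eval R R id x p = (\<Oplus>j\<in>{..deg R p}. p j \<otimes> x [^] j)"
      using pP by (simp add: eval_def cp)
    also have "\<dots> = (\<Oplus>j\<in>{..<n}. c j \<otimes> x [^] j)"
      using deg x high by (intro extend) (auto simp: p_def)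
    finally show ?thesis .
  qed
  have "S \<subseteq> {a \<in> carrier R. eval R R id a p = \<zero>}"
    using S roots by (auto simp: ev subset_iff)
  then have "card S \<le> deg R p"
    using roots_bound[OF pP p0 fin] card_mono order_trans by blast
  then show False using S deg by simp
qed

section \<open>Evaluation of integer polynomials\<close>

text \<open>Integer polynomials stand in for polynomials over the prime field: one \<open>p\<close>
  can be evaluated in rings of different types, with no prime field to construct. The fold is
  Horner's scheme.\<close>

definition int_eval :: "('a, 'c) ring_scheme \<Rightarrow> 'a \<Rightarrow> int poly \<Rightarrow> 'a" where
  "int_eval R x = (\<lambda>p. fold_coeffs (\<lambda>a v. [a] \<cdot>\<^bsub>R\<^esub> \<one>\<^bsub>R\<^esub> \<oplus>\<^bsub>R\<^esub> x \<otimes>\<^bsub>R\<^esub> v) p \<zero>\<^bsub>R\<^esub>)"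

context cring
begin

lemma add_pow_int_0 [simp]: "[(0 :: int)] \<cdot> x = \<zero>"
  by (simp add: add_pow_int_ge)

lemma int_eval_0 [simp]: "int_eval R x 0 = \<zero>"
  by (simp add: int_eval_def)

lemma int_eval_pCons [simp]:
  assumes "x \<in> carrier R"
  shows "int_eval R x (pCons a p) = [a] \<cdot> \<one> \<oplus> x \<otimes> int_eval R x p"
\<comment> \<open>\<open>fold_coeffs\<close> takes no step on the zero polynomial, so Horner's rule
  is checked separately there.\<close>
proof (cases "p = 0 \<and> a = 0")
  case True
  then show ?thesis using assms by simp
next
  case False
  then show ?thesis by (auto simp: int_eval_def)
qed

lemma int_eval_closed [simp, intro]: "x \<in> carrier R \<Longrightarrow> int_eval R x p \<in> carrier R"
  by (induction p) auto

lemma int_eval_add: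
  assumes "x \<in> carrier R"
  shows "int_eval R x (p + q) = int_eval R x p \<oplus> int_eval R x q"
proof (induction p q rule: poly_induct2)
  case (pCons a p b q)
  then show ?case
    using assms by (simp add: add.int_pow_mult r_distr a_ac)
qed simp

lemma int_eval_smult:
  assumes "x \<in> carrier R"
  shows "int_eval R x (Polynomial.smult a p) = [a] \<cdot> int_eval R x p"
proof (induction p)
  case (pCons b p)
  then show ?case
    using assms by (simp add: add.int_pow_pow add.int_pow_distrib add_pow_rdistr_int mult.commute)
qed simp

lemma int_eval_mult:
  assumes "x \<in> carrier R"
  shows "int_eval R x (p * q) = int_eval R x p \<otimes> int_eval R x q"
proof (induction p)
  case (pCons a p)
  then show ?case
    using assms by (simp add: int_eval_add int_eval_smult l_distr add_pow_ldistr_int m_assoc)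
qed (use assms in simp)

lemma int_eval_1: "x \<in> carrier R \<Longrightarrow> int_eval R x 1 = \<one>"
  by (simp add: one_pCons)

lemma int_eval_diff:
  assumes "x \<in> carrier R"
  shows "int_eval R x (p - q) = int_eval R x p \<ominus> int_eval R x q"
proof -
  have "int_eval R x p = int_eval R x (p - q) \<oplus> int_eval R x q"
    by (metis int_eval_add assms diff_add_cancel)
  then show ?thesis
    using assms by (simp add: a_minus_def a_assoc r_neg)
qed

lemma int_eval_monom:
  assumes "x \<in> carrier R"
  shows "int_eval R x (Polynomial.monom 1 n) = x [^] n"
proof (induction n)
  case (Suc n)
  then show ?case
    using assms by (simp add: monom_Suc m_comm)
qed (use assms in \<open>simp add: int_eval_1\<close>)

text \<open>Brings Horner's scheme into the shape that \<open>many_roots_imp_coeffs_zero\<close>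
  expects.\<close>

lemma int_eval_altdef:
  assumes "x \<in> carrier R" "degree p < n"
  shows "int_eval R x p = (\<Oplus>i\<in>{..<n}. ([Polynomial.coeff p i] \<cdot> \<one>) \<otimes> x [^] i)"
  using assms(2)
proof (induction p arbitrary: n)
  case 0
  then show ?case using assms by (simp)
next
  case (pCons a p)
  obtain k where n: "n = Suc k" using pCons.prems by (cases n) auto
  show ?case
  proof (cases "p = 0")
    case True
    have "(\<Oplus>i\<in>{..<n}. ([Polynomial.coeff [:a:] i] \<cdot> \<one>) \<otimes> x [^] i)
        = (\<Oplus>i\<in>{0::nat}. ([a] \<cdot> \<one>) \<otimes> x [^] i)"
      by (rule add.finprod_mono_neutral_cong_right)
        (use assms n in \<open>auto simp: coeff_pCons split: nat.splits\<close>)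
    then show ?thesis using True assms by simp
  next
    case False
    then have k: "degree p < k" using pCons.prems n by simp
    have lt: "{..<Suc j} = {..j}" for j :: nat by auto
    obtain j where j: "k = Suc j" using k by (cases k) auto
    have "(\<Oplus>i\<in>{..<n}. ([Polynomial.coeff (pCons a p) i] \<cdot> \<one>) \<otimes> x [^] i)
      = (\<Oplus>i\<in>{..j}. ([Polynomial.coeff p i] \<cdot> \<one>) \<otimes> x [^] Suc i) \<oplus> [a] \<cdot> \<one>"
      unfolding n j lt by (subst finsum_Suc2) (use assms in auto)
    also have "(\<Oplus>i\<in>{..j}. ([Polynomial.coeff p i] \<cdot> \<one>) \<otimes> x [^] Suc i)
       = x \<otimes> (\<Oplus>i\<in>{..j}. ([Polynomial.coeff p i] \<cdot> \<one>) \<otimes> x [^] i)"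
      using assms by (subst finsum_rdistr) (auto simp: m_ac intro!: finsum_cong')
    also have "(\<Oplus>i\<in>{..j}. ([Polynomial.coeff p i] \<cdot> \<one>) \<otimes> x [^] i) = int_eval R x p"
      using pCons.IH[OF k] by (simp add: j lt)
    finally show ?thesis using assms by (simp add: a_comm)
  qed
qed

end

section \<open>Finite fields: characteristic and embeddings\<close>

text \<open>Lagrange in the unit group gives the exponent \<open>order R - 1\<close>; one more
  factor also covers \<open>\<zero>\<close>.\<close>

lemma (in field) pow_order_eq_self:
  assumes "finite (carrier R)" "x \<in> carrier R"
  shows "x [^] order R = x"
proof (cases "x = \<zero>")
  case True
  have "order R > 0" using assms by (simp add: order_gt_0_iff_finite)
  then show ?thesis using True by (simp add: nat_pow_zero)
next
  case False
  interpret M: group "mult_of R" by (rule field_mult_group)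
  have "x [^] (order R - 1) = \<one>"
    using M.pow_order_eq_1[of x] False assms by (simp add: order_mult_of nat_pow_mult_of)
  moreover have "order R = Suc (order R - 1)"
    using assms order_gt_0_iff_finite by (metis Suc_diff_1)
  ultimately show ?thesis using assms by (metis nat_pow_Suc l_one)
qed

text \<open>Sylow's theorem with exponent 1 yields a subgroup of order \<open>p\<close> of the
  additive group. A nonzero \<open>x\<close> in it is killed by \<open>p\<close>, and
  \<open>x\<close> can be cancelled in a field.\<close>

lemma (in field) prime_dvd_order_imp_char:
  assumes fin: "finite (carrier R)" and p: "prime (p :: nat)" "p dvd order R"
  shows "[int p] \<cdot> \<one> = \<zero>"
proof -
  obtain n where n: "order R = p * n" using p by blast
  have "order (add_monoid R) = p ^ 1 * n" using n by (simp add: order_def)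
  then obtain H where H: "subgroup H (add_monoid R)" "card H = p ^ 1"
    using sylow_thm[OF p(1) add.is_group, of 1 n] fin by auto
  have finH: "finite H" using H p prime_gt_0_nat by (metis card_gt_0_iff power_one_right)
  obtain x where x: "x \<in> H" "x \<noteq> \<zero>"
  proof -
    have "\<not> H \<subseteq> {\<zero>}"
      using H(2) p(1) card_mono[of "{\<zero>}" H] prime_gt_1_nat[of p] by auto
    then show ?thesis using that by blast
  qed
  have xR: "x \<in> carrier R" using x subgroup.subset[OF H(1)] by auto
  interpret H: group "add_monoid R\<lparr>carrier := H\<rparr>"
    by (rule subgroup.subgroup_is_group[OF H(1) add.is_group])
  have "x [^]\<^bsub>add_monoid R\<lparr>carrier := H\<rparr>\<^esub> order (add_monoid R\<lparr>carrier := H\<rparr>) = \<one>\<^bsub>add_monoid R\<lparr>carrier := H\<rparr>\<^esub>"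
    by (rule H.pow_order_eq_1) (use x in auto)
  then have "[p] \<cdot> x = \<zero>"
    using H(2) by (simp add: order_def add_pow_def nat_pow_def)
  then have "([int p] \<cdot> \<one>) \<otimes> x = \<zero>"
    using xR by (simp add: add_pow_ldistr add_pow_int_ge)
  then show ?thesis
    using x xR integral by blast
qed

text \<open>A monic integer polynomial of minimal degree \<open>d\<close> killing \<open>g\<close> serves as minimal polynomial over the
  prime field: modulo \<open>p\<close> every leading coefficient is zero or can be normalized to 1, so anything of
  smaller degree killing \<open>g\<close> has all coefficients divisible by \<open>p\<close>.\<close>

lemma int_eval_eq_0_if_degree_less:
  fixes p d :: nat and u :: "int poly"
  assumes R: "cring R" and S: "cring S" and g: "g \<in> carrier R" and h: "h \<in> carrier S"
    and p: "prime p" "[int p] \<cdot>\<^bsub>R\<^esub> \<one>\<^bsub>R\<^esub> = \<zero>\<^bsub>R\<^esub>" "[int p] \<cdot>\<^bsub>S\<^esub> \<one>\<^bsub>S\<^esub> = \<zero>\<^bsub>S\<^esub>"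
    and min: "\<And>f. lead_coeff f = 1 \<Longrightarrow> int_eval R g f = \<zero>\<^bsub>R\<^esub> \<Longrightarrow> d \<le> degree f"
    and u: "int_eval R g u = \<zero>\<^bsub>R\<^esub>" "degree u < d"
  shows "int_eval S h u = \<zero>\<^bsub>S\<^esub>"
  using u
proof (induction "degree u" arbitrary: u rule: less_induct)
  case less
  interpret R: cring R by fact
  interpret S: cring S by fact
  have red: "[(int p * a)] \<cdot>\<^bsub>R\<^esub> x = \<zero>\<^bsub>R\<^esub>" if "x \<in> carrier R" for a x
  proof -
    have "[int p] \<cdot>\<^bsub>R\<^esub> ([a] \<cdot>\<^bsub>R\<^esub> x) = \<zero>\<^bsub>R\<^esub>"
      using R.add_pow_ldistr_int[of "\<one>\<^bsub>R\<^esub>" "[a] \<cdot>\<^bsub>R\<^esub> x" "int p"] that p(2) by simp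
    then show ?thesis using that by (simp add: R.add.int_pow_pow mult.commute)
  qed
  have red': "[(int p * a)] \<cdot>\<^bsub>S\<^esub> x = \<zero>\<^bsub>S\<^esub>" if "x \<in> carrier S" for a x
  proof -
    have "[int p] \<cdot>\<^bsub>S\<^esub> ([a] \<cdot>\<^bsub>S\<^esub> x) = \<zero>\<^bsub>S\<^esub>"
      using S.add_pow_ldistr_int[of "\<one>\<^bsub>S\<^esub>" "[a] \<cdot>\<^bsub>S\<^esub> x" "int p"] that p(3) by simp
    then show ?thesis using that by (simp add: S.add.int_pow_pow mult.commute)
  qed
  define a n where "a = lead_coeff u" and "n = degree u"
  show ?case
  proof (cases "u = 0")
    case True
    then show ?thesis by simp
  next
    case u0: False
    show ?thesis
    proof (cases "int p dvd a")
      case False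
      then have "coprime a (int p)"
        using p(1) prime_imp_coprime[of "int p" a] by (simp add: coprime_commute)
      then obtain b c where bc: "b * a + c * int p = 1"
        using bezout_int[of a "int p"] by auto
      \<comment> \<open>\<open>b\<close> inverts the leading coefficient modulo \<open>p\<close>.
        The added monomial has a coefficient divisible by \<open>p\<close>, so it vanishes at
        \<open>g\<close>, and it makes the top coefficient exactly 1; this contradicts the
        minimality of \<open>d\<close>.\<close>
      define w where "w = Polynomial.smult b u + Polynomial.monom (c * int p) n"
      have cw: "Polynomial.coeff w n = 1"
        using bc by (simp add: w_def a_def n_def)
      have "degree w \<le> n"
        unfolding w_def n_def
        by (intro degree_add_le) (auto intro: degree_monom_le order_trans[OF degree_smult_le])
      moreover have "degree w \<ge> n" using cw by (intro le_degree) simp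
      ultimately have dw: "degree w = n" by simp
      have "w = Polynomial.smult b u + Polynomial.smult (int p * c) (Polynomial.monom 1 n)"
        by (simp add: w_def Polynomial.smult_monom mult.commute)
      then have "int_eval R g w = \<zero>\<^bsub>R\<^esub>"
        using less.prems g by (simp add: R.int_eval_add R.int_eval_smult red)
      then have "d \<le> n" using min[of w] cw dw by simp
      then show ?thesis using less.prems n_def by simp
    next
      case True
      then obtain b where b: "a = int p * b" by blast
      \<comment> \<open>The leading term is a multiple of \<open>p\<close>, hence zero in both
        rings; removing it lowers the degree for the induction.\<close>
      define w where "w = u - Polynomial.smult (int p * b) (Polynomial.monom 1 n)"
      have w: "w = u - Polynomial.monom (lead_coeff u) (degree u)"
        by (simp add: w_def Polynomial.smult_monom a_def[symmetric] b n_def)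
      have ug: "u = w + Polynomial.smult (int p * b) (Polynomial.monom 1 n)" by (simp add: w_def)
      have wR: "int_eval R g w = \<zero>\<^bsub>R\<^esub>"
        using less.prems g unfolding w_def 
        by (simp add: R.int_eval_diff R.int_eval_smult red)
      have "int_eval S h w = \<zero>\<^bsub>S\<^esub>"
      \<comment> \<open>A constant leaves no smaller degree to induct on, but then \<open>w\<close>
        is already zero.\<close>
      proof (cases "degree u = 0")
        case True
        then have "w = 0" unfolding w by (metis degree_0_id diff_self monom_0)
        then show ?thesis by simp
      next
        case False
        have "degree w < degree u"
        proof (rule degree_lessI)
          show "w \<noteq> 0 \<or> 0 < degree u" using False by simp
          show "\<forall>k\<ge>degree u. Polynomial.coeff w k = 0"
            by (auto simp: w coeff_eq_0 le_less)
        qed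
        then show ?thesis using less.hyps[of w] wR less.prems by simp
      qed
      then show ?thesis
        unfolding ug using h by (simp add: S.int_eval_add S.int_eval_smult red')
    qed
  qed
qed

text \<open>Pseudo-division scales the dividend by a power of the leading coefficient, here 1.
  Positive degree of \<open>f\<close> makes the degree bound hold for a zero remainder too.\<close>

lemma monic_division:
  fixes f P :: "int poly"
  assumes "lead_coeff f = 1" "degree f > 0"
  obtains s u where "P = f * s + u" "degree u < degree f"
proof -
  obtain s u where su: "pseudo_divmod P f = (s, u)" by fastforce
  have f: "f \<noteq> 0" using assms by auto
  show ?thesis
    using that[of s u] pseudo_divmod[OF f su] assms by auto
qed

text \<open>With \<open>g\<close> a generator of \<open>F\<close> and \<open>f\<close> its minimal polynomial in the above sense, \<open>f\<close> divides
  \<open>X ^ |K| - X\<close> up to a remainder vanishing on \<open>K\<close>. Counting roots shows that \<open>f\<close> has a root \<open>h\<close> in \<open>K\<close>,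
  and \<open>P(g) \<mapsto> P(h)\<close> is the embedding.\<close>

lemma finite_field_embedding:
  assumes F: "field F" "finite (carrier F)" and K: "field K" "order K = order F ^ t" "t > 0"
  shows "\<exists>\<phi>. \<phi> \<in> ring_hom F K"
proof -
  interpret F: field F by fact
  interpret K: field K by fact
  have q0: "order F > 0" using F by (simp add: F.order_gt_0_iff_finite)
  have "card {\<zero>\<^bsub>F\<^esub>, \<one>\<^bsub>F\<^esub>} \<le> order F"
    unfolding order_def using F by (intro card_mono) auto
  then have q1: "order F > 1" by simp
  have finK: "finite (carrier K)"
    using K q0 K.order_gt_0_iff_finite by simp
  obtain p where p: "prime p" "p dvd order F"
    using q1 prime_factor_nat[of "order F"] by auto
  have pF: "[int p] \<cdot>\<^bsub>F\<^esub> \<one>\<^bsub>F\<^esub> = \<zero>\<^bsub>F\<^esub>"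
    using F.prime_dvd_order_imp_char F p by blast
  have "p dvd order K" using p K by (metis dvd_power dvd_trans)
  then have pK: "[int p] \<cdot>\<^bsub>K\<^esub> \<one>\<^bsub>K\<^esub> = \<zero>\<^bsub>K\<^esub>"
    using K.prime_dvd_order_imp_char finK p by blast

  obtain g where g: "g \<in> carrier (mult_of F)" "carrier (mult_of F) = {g [^]\<^bsub>F\<^esub> i | i::nat. i \<in> UNIV}"
    using F.finite_field_mult_group_has_gen F by blast
  have gF: "g \<in> carrier F" using g by simp
  \<comment> \<open>Powers of the generator \<open>g\<close> reach all units, so monomials and 0
    suffice.\<close>
  have surj: "\<exists>P. int_eval F g P = y" if y: "y \<in> carrier F" for y
  proof (cases "y = \<zero>\<^bsub>F\<^esub>")
    case True
    then show ?thesis by (metis F.int_eval_0)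
  next
    case False
    then have "y \<in> carrier (mult_of F)" using y by simp
    then obtain i :: nat where "y = g [^]\<^bsub>F\<^esub> i" using g(2) by auto
    then show ?thesis using F.int_eval_monom[OF gF] by metis
  qed

  define N where "N = order K"
  define X where "X = Polynomial.monom (1::int) N - Polynomial.monom 1 1"
  have N1: "N > 1" unfolding N_def K(2) using K(3) q1 by (rule one_less_power[rotated])
  have XK: "int_eval K x X = \<zero>\<^bsub>K\<^esub>" if "x \<in> carrier K" for x
    using that finK K.pow_order_eq_self[of x]
    by (simp add: X_def K.int_eval_diff K.int_eval_monom N_def K.r_neg)
  \<comment> \<open>The \<open>order F\<close>-th power map is iterated: as \<open>order K\<close>
    is a power of \<open>order F\<close>, \<open>X\<close> kills \<open>g\<close> as well as all of
    \<open>K\<close>.\<close>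
  have powF: "x [^]\<^bsub>F\<^esub> (order F ^ k) = x" if "x \<in> carrier F" for x k
    using that by (induction k) (simp_all add: F.nat_pow_pow[symmetric] F.pow_order_eq_self F(2) mult.commute)
  have XF: "int_eval F g X = \<zero>\<^bsub>F\<^esub>"
    using gF by (simp add: X_def F.int_eval_diff F.int_eval_monom N_def K powF F.r_neg)
  have degX: "degree X = N" "lead_coeff X = 1"
  proof -
    have c: "Polynomial.coeff X N = 1" using N1 by (simp add: X_def)
    have "degree X \<le> N" unfolding X_def
      using N1 by (intro degree_diff_le) (auto intro: order_trans[OF degree_monom_le])
    moreover have "N \<le> degree X" using c by (intro le_degree) simp
    ultimately show "degree X = N" by simp
    then show "lead_coeff X = 1" using c by simp
  qed

  define d where "d = (LEAST d. \<exists>f. lead_coeff f = 1 \<and> int_eval F g f = \<zero>\<^bsub>F\<^esub> \<and> degree f = d)"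
  have "\<exists>d f. lead_coeff f = 1 \<and> int_eval F g f = \<zero>\<^bsub>F\<^esub> \<and> degree f = d"
    using degX XF by blast
  from LeastI_ex[OF this] obtain f where
    f: "lead_coeff f = 1" "int_eval F g f = \<zero>\<^bsub>F\<^esub>" "degree f = d"
    unfolding d_def by blast
  have min: "d \<le> degree f'" if "lead_coeff f' = 1" "int_eval F g f' = \<zero>\<^bsub>F\<^esub>" for f'
    unfolding d_def by (rule Least_le) (use that in blast)
  have d0: "degree f > 0"
  proof (rule ccontr)
    assume "\<not> degree f > 0"
    then obtain c where "f = [:c:]" by (auto elim: degree_eq_zeroE)
    then have "f = 1" using f(1) by (simp add: one_pCons)
    then show False using f(2) gF by (simp add: F.int_eval_1)
  qed
  \<comment> \<open>This moves the vanishing of a remainder modulo \<open>f\<close> from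
    \<open>g\<close> to any point of \<open>K\<close>.\<close>
  note small = int_eval_eq_0_if_degree_less[OF F.is_cring K.is_cring gF _ p(1) pF pK min]

  have "\<exists>h\<in>carrier K. int_eval K h f = \<zero>\<^bsub>K\<^esub>"
  proof (rule ccontr)
    assume no: "\<not> ?thesis"
    obtain s u where su: "X = f * s + u" "degree u < degree f"
      using monic_division[OF f(1) d0] by blast
    have "int_eval F g u = \<zero>\<^bsub>F\<^esub>"
      using XF f(2) gF by (simp add: su(1) F.int_eval_add F.int_eval_mult)
    then have uK: "int_eval K x u = \<zero>\<^bsub>K\<^esub>" if "x \<in> carrier K" for x
      using small[OF that] su f(3) by blast
    \<comment> \<open>Without a root of \<open>f\<close>, the cofactor \<open>s\<close> would vanish
      on all of \<open>K\<close>, although it is monic of degree below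
      \<open>order K\<close>.\<close>
    have sK: "int_eval K x s = \<zero>\<^bsub>K\<^esub>" if "x \<in> carrier K" for x
    proof -
      have "int_eval K x f \<otimes>\<^bsub>K\<^esub> int_eval K x s = \<zero>\<^bsub>K\<^esub>"
        using XK[OF that] uK[OF that] that by (simp add: su(1) K.int_eval_add K.int_eval_mult)
      then show ?thesis using no that K.integral by blast
    qed
    have s0: "s \<noteq> 0"
    proof
      assume "s = 0"
      then have "degree X < degree f" using su by simp
      then show False using min[OF degX(2) XF] f(3) by simp
    qed
    have fs: "degree (f * s) = degree f + degree s"
      using f(1) s0 by (intro degree_mult_eq) auto
    have "degree (f * s + u) = degree (f * s)"
      using su fs by (intro degree_add_eq_left) simp
    then have ds: "degree s < N" and lX: "degree X = degree f + degree s"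
      using fs d0 su(1) degX by simp_all
    have "Polynomial.coeff X (degree X) = lead_coeff f * lead_coeff s"
      using su lX by (simp add: coeff_mult_degree_sum coeff_eq_0)
    then have ls: "lead_coeff s = 1" using f(1) degX by simp
    have "([Polynomial.coeff s (degree s)] \<cdot>\<^bsub>K\<^esub> \<one>\<^bsub>K\<^esub>) = \<zero>\<^bsub>K\<^esub>"
      by (rule K.many_roots_imp_coeffs_zero[of _ N "carrier K"])
        (use finK sK ds in \<open>auto simp: K.int_eval_altdef[symmetric] N_def order_def\<close>)
    then show False using ls by (simp add: add_pow_int_ge)
  qed
  then obtain h where h: "h \<in> carrier K" "int_eval K h f = \<zero>\<^bsub>K\<^esub>" by blast
  have ker: "int_eval K h P = \<zero>\<^bsub>K\<^esub>" if P: "int_eval F g P = \<zero>\<^bsub>F\<^esub>" for P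
  proof -
    obtain s u where su: "P = f * s + u" "degree u < degree f"
      using monic_division[OF f(1) d0] by blast
    have "int_eval F g u = \<zero>\<^bsub>F\<^esub>"
      using P f(2) gF by (simp add: su(1) F.int_eval_add F.int_eval_mult)
    then have "int_eval K h u = \<zero>\<^bsub>K\<^esub>"
      using small[OF h(1)] su f(3) by blast
    then show ?thesis using h by (simp add: su(1) K.int_eval_add K.int_eval_mult)
  qed
  have cong: "int_eval K h P = int_eval K h Q" if "int_eval F g P = int_eval F g Q" for P Q
  proof -
    have "int_eval F g (P - Q) = \<zero>\<^bsub>F\<^esub>"
      using that gF by (simp add: F.int_eval_diff F.r_neg)
    from ker[OF this] show ?thesis
      using h by (simp add: K.int_eval_diff)
  qed
  \<comment> \<open>By \<open>cong\<close> the value does not depend on which polynomial represents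
    \<open>y\<close>.\<close>
  define \<phi> where "\<phi> y = int_eval K h (SOME P. int_eval F g P = y)" for y
  have \<phi>: "\<phi> (int_eval F g P) = int_eval K h P" for P
    unfolding \<phi>_def by (rule cong) (rule someI, rule refl)
  have "\<phi> \<in> ring_hom F K"
  proof (rule ring_hom_memI)
    fix x y assume "x \<in> carrier F" "y \<in> carrier F"
    then obtain P Q where PQ: "x = int_eval F g P" "y = int_eval F g Q" using surj by metis
    show "\<phi> (x \<otimes>\<^bsub>F\<^esub> y) = \<phi> x \<otimes>\<^bsub>K\<^esub> \<phi> y"
      using gF h \<phi>[of "P * Q"] by (simp add: PQ \<phi> F.int_eval_mult K.int_eval_mult)
    show "\<phi> (x \<oplus>\<^bsub>F\<^esub> y) = \<phi> x \<oplus>\<^bsub>K\<^esub> \<phi> y"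
      using gF h \<phi>[of "P + Q"] by (simp add: PQ \<phi> F.int_eval_add K.int_eval_add)
  next
    show "\<phi> \<one>\<^bsub>F\<^esub> = \<one>\<^bsub>K\<^esub>"
      using gF h \<phi>[of 1] by (simp add: F.int_eval_1 K.int_eval_1)
  qed (auto simp: \<phi>_def h)
  then show ?thesis by blast
qed

section \<open>Frobenius, orders and roots in finite fields\<close>

lemma diff_one_dvd_power_diff_one: "q - 1 dvd q ^ s - (1 :: nat)"
proof (cases "q = 0")
  case False
  show ?thesis
  proof (induction s)
    case (Suc s)
    have "q ^ Suc s - 1 = q * (q ^ s - 1) + (q - 1)"
      using False by (simp add: algebra_simps)
    then show ?case using Suc by simp
  qed simp
qed (simp add: power_0_left)

lemma (in ring_hom_cring) hom_add_pow_int: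
  assumes "x \<in> carrier R"
  shows "h ([(k :: int)] \<cdot> x) = [k] \<cdot>\<^bsub>S\<^esub> h x"
proof -
  have nat: "h ([(n :: nat)] \<cdot> x) = [n] \<cdot>\<^bsub>S\<^esub> h x" for n
    using assms by (induction n) simp_all
  show ?thesis
    using assms by (cases "k \<ge> 0") (simp_all add: add_pow_int_ge add_pow_int_lt nat)
qed

text \<open>The polynomial \<open>(X + 1)\<^sup>q - X\<^sup>q - 1\<close> has degree less than \<open>q\<close> and vanishes on the \<open>q\<close>
  elements of \<open>F\<close>, so its integer coefficients are zero in \<open>F\<close>, hence also in \<open>K\<close>.\<close>

lemma finite_field_frobenius_add:
  assumes F: "field F" "finite (carrier F)" and K: "field K" and \<phi>: "\<phi> \<in> ring_hom F K"
    and x: "x \<in> carrier K" and y: "y \<in> carrier K"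
  shows "(x \<oplus>\<^bsub>K\<^esub> y) [^]\<^bsub>K\<^esub> order F = x [^]\<^bsub>K\<^esub> order F \<oplus>\<^bsub>K\<^esub> y [^]\<^bsub>K\<^esub> order F"
proof -
  interpret F: field F by fact
  interpret K: field K by fact
  interpret ring_hom_cring F K \<phi>
    by (simp add: ring_hom_cring_def ring_hom_cring_axioms_def F.is_cring K.is_cring \<phi>)
  define q where "q = order F"
  have q0: "q > 0" using F by (simp add: F.order_gt_0_iff_finite q_def)
  define w where "w = [:1, 1:] ^ q - (Polynomial.monom 1 q + (1 :: int poly))"
  have dq: "degree ([:1, 1::int:] ^ q) = q" by (simp add: degree_power_eq)
  have lq: "Polynomial.coeff ([:1, 1::int:] ^ q) q = 1"
    using lead_coeff_power[of "[:1, 1::int:]" q] dq by simp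
  have dw: "degree w < q"
  proof (rule degree_lessI)
    show "w \<noteq> 0 \<or> 0 < q" using q0 by simp
    show "\<forall>k\<ge>q. Polynomial.coeff w k = 0"
      using q0 dq lq by (auto simp: w_def coeff_eq_0 le_less coeff_1)
  qed
  have pow: "int_eval R z (P ^ k) = int_eval R z P [^]\<^bsub>R\<^esub> k"
    if "cring R" "z \<in> carrier R" for R :: "('x, 'y) ring_scheme" and z P k
  proof -
    interpret R: cring R by fact
    show ?thesis
      using that by (induction k) (simp_all add: R.int_eval_mult R.int_eval_1 R.m_comm)
  qed
  \<comment> \<open>Stated for every commutative ring, since it is applied in both \<open>F\<close>
    and \<open>K\<close>.\<close>
  have ev: "int_eval R z w = (\<one>\<^bsub>R\<^esub> \<oplus>\<^bsub>R\<^esub> z) [^]\<^bsub>R\<^esub> q \<ominus>\<^bsub>R\<^esub> (z [^]\<^bsub>R\<^esub> q \<oplus>\<^bsub>R\<^esub> \<one>\<^bsub>R\<^esub>)"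
    if "cring R" "z \<in> carrier R" for R :: "('x, 'y) ring_scheme" and z
  proof -
    interpret R: cring R by fact
    show ?thesis
      using that unfolding w_def
      by (simp add: R.int_eval_diff R.int_eval_add R.int_eval_monom R.int_eval_1 pow add_pow_int_ge)
  qed
  have "[Polynomial.coeff w i] \<cdot>\<^bsub>F\<^esub> \<one>\<^bsub>F\<^esub> = \<zero>\<^bsub>F\<^esub>" if "i < q" for i
  proof (rule F.many_roots_imp_coeffs_zero[of _ q "carrier F"])
    fix z assume z: "z \<in> carrier F"
    have "int_eval F z w = \<zero>\<^bsub>F\<^esub>"
      using z F by (simp add: ev F.is_cring F.pow_order_eq_self q_def F.a_comm)
    then show "(\<Oplus>\<^bsub>F\<^esub>i\<in>{..<q}. ([Polynomial.coeff w i] \<cdot>\<^bsub>F\<^esub> \<one>\<^bsub>F\<^esub>) \<otimes>\<^bsub>F\<^esub> z [^]\<^bsub>F\<^esub> i) = \<zero>\<^bsub>F\<^esub>"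
      using F.int_eval_altdef[OF z dw] by simp
  qed (use F that in \<open>auto simp: q_def order_def\<close>)
  then have cK: "[Polynomial.coeff w i] \<cdot>\<^bsub>K\<^esub> \<one>\<^bsub>K\<^esub> = \<zero>\<^bsub>K\<^esub>" if "i < q" for i
    using that hom_add_pow_int[of "\<one>\<^bsub>F\<^esub>" "Polynomial.coeff w i"] by simp
  have one: "(\<one>\<^bsub>K\<^esub> \<oplus>\<^bsub>K\<^esub> z) [^]\<^bsub>K\<^esub> q = z [^]\<^bsub>K\<^esub> q \<oplus>\<^bsub>K\<^esub> \<one>\<^bsub>K\<^esub>" if z: "z \<in> carrier K" for z
  proof -
    have "int_eval K z w = (\<Oplus>\<^bsub>K\<^esub>i\<in>{..<q}. ([Polynomial.coeff w i] \<cdot>\<^bsub>K\<^esub> \<one>\<^bsub>K\<^esub>) \<otimes>\<^bsub>K\<^esub> z [^]\<^bsub>K\<^esub> i)"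
      by (rule K.int_eval_altdef[OF z dw])
    also have "\<dots> = \<zero>\<^bsub>K\<^esub>"
      by (rule K.add.finprod_one_eqI) (use cK z in simp)
    finally show ?thesis using z by (simp add: ev K.is_cring)
  qed
  show ?thesis
  proof (cases "x = \<zero>\<^bsub>K\<^esub>")
    case True
    then show ?thesis using y q0 by (simp add: K.nat_pow_zero q_def)
  next
    case False
    \<comment> \<open>Factoring out \<open>x\<close> reduces the claim to a sum with one summand
      equal to 1.\<close>
    define z where "z = inv\<^bsub>K\<^esub> x \<otimes>\<^bsub>K\<^esub> y"
    have xu: "x \<in> Units K" using False x by (simp add: K.field_Units)
    have z: "z \<in> carrier K" using xu y by (simp add: z_def)
    have yz: "y = x \<otimes>\<^bsub>K\<^esub> z" using xu x y by (simp add: z_def K.m_assoc[symmetric])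
    have "x \<oplus>\<^bsub>K\<^esub> y = x \<otimes>\<^bsub>K\<^esub> (\<one>\<^bsub>K\<^esub> \<oplus>\<^bsub>K\<^esub> z)"
      using x z by (simp add: yz K.r_distr)
    then have "(x \<oplus>\<^bsub>K\<^esub> y) [^]\<^bsub>K\<^esub> q = x [^]\<^bsub>K\<^esub> q \<otimes>\<^bsub>K\<^esub> (z [^]\<^bsub>K\<^esub> q \<oplus>\<^bsub>K\<^esub> \<one>\<^bsub>K\<^esub>)"
      using one[OF z] x z by (simp add: K.nat_pow_distrib)
    also have "\<dots> = x [^]\<^bsub>K\<^esub> q \<oplus>\<^bsub>K\<^esub> y [^]\<^bsub>K\<^esub> q"
      using x z by (simp add: yz K.nat_pow_distrib K.r_distr K.a_comm)
    finally show ?thesis by (simp add: q_def)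
  qed
qed

text \<open>Divide \<open>q^(s+1) - 1 = (q^s - 1) q + (q - 1)\<close> by \<open>m\<close> in the
  exponent; the factor \<open>q\<close> disappears because the \<open>q\<close>-th power map fixes
  every element.\<close>

lemma (in field) pow_diff_one_quotient:
  assumes fin: "finite (carrier R)" and m: "m dvd order R - 1" and r: "r \<in> carrier R"
  shows "r [^] ((order R ^ s - 1) div m) = (r [^] ((order R - 1) div m)) [^] s"
proof (induction s)
  case (Suc s)
  define q where "q = order R"
  have q0: "q > 0" using fin by (simp add: order_gt_0_iff_finite q_def)
  have ms: "m dvd q ^ s - 1"
    using m dvd_trans diff_one_dvd_power_diff_one unfolding q_def by blast
  have "q ^ Suc s - 1 = (q ^ s - 1) * q + (q - 1)"
    using q0 by (simp add: algebra_simps)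
  then have "(q ^ Suc s - 1) div m = ((q ^ s - 1) div m) * q + (q - 1) div m"
    using ms m unfolding q_def by (simp add: div_plus_div_distrib_dvd_left dvd_div_mult)
  then have "r [^] ((q ^ Suc s - 1) div m) = (r [^] ((q ^ s - 1) div m)) [^] q \<otimes> r [^] ((q - 1) div m)"
    using r by (simp add: nat_pow_mult[symmetric] nat_pow_pow)
  then show ?case
    using Suc r fin by (simp add: q_def pow_order_eq_self)
qed (use assms in simp)

text \<open>Dividing by \<open>m\<close> turns the left side into
  \<open>r [^] ((q^s - 1) div m) = \<one>\<close>, and that power is the \<open>s\<close>-th power
  of the element on the right.\<close>

lemma (in field) ord_mult_dvd_power_diff_one_iff:
  assumes fin: "finite (carrier R)" and m: "m dvd order R - 1" "m > 0" and r: "r \<in> carrier (mult_of R)"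
  shows "group.ord (mult_of R) r * m dvd order R ^ s - 1
    \<longleftrightarrow> group.ord (mult_of R) (r [^] ((order R - 1) div m)) dvd s"
proof -
  interpret M: group "mult_of R" by (rule field_mult_group)
  define \<eta> where "\<eta> = r [^] ((order R - 1) div m)"
  have \<eta>: "\<eta> \<in> carrier (mult_of R)"
    using M.nat_pow_closed[OF r] by (simp add: \<eta>_def nat_pow_mult_of)
  have "m dvd order R ^ s - 1" using m diff_one_dvd_power_diff_one by (blast intro: dvd_trans)
  then have "M.ord r * m dvd order R ^ s - 1 \<longleftrightarrow> M.ord r dvd (order R ^ s - 1) div m"
    using m by (simp add: dvd_div_iff_mult)
  also have "\<dots> \<longleftrightarrow> r [^] ((order R ^ s - 1) div m) = \<one>"
    using M.pow_eq_id[OF r] by (simp add: nat_pow_mult_of)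
  also have "\<dots> \<longleftrightarrow> \<eta> [^] s = \<one>"
    using pow_diff_one_quotient[OF fin m(1)] r by (simp add: \<eta>_def)
  also have "\<dots> \<longleftrightarrow> M.ord \<eta> dvd s"
    using M.pow_eq_id[OF \<eta>] by (simp add: nat_pow_mult_of)
  finally show ?thesis unfolding \<eta>_def .
qed

text \<open>Write \<open>a = g [^] k\<close> with a generator \<open>g\<close>. From
  \<open>a [^] e = \<one>\<close>, \<open>order R - 1\<close> divides \<open>k * e\<close>; hence so
  does \<open>e * m\<close>, thus \<open>m\<close> divides \<open>k\<close>, and
  \<open>g [^] (k div m)\<close> is a root.\<close>

lemma (in field) exists_root:
  assumes fin: "finite (carrier R)" and a: "a \<in> carrier (mult_of R)" "a [^] (e :: nat) = \<one>"
    and e: "e > 0" "e * m dvd order R - 1"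
  obtains b where "b \<in> carrier (mult_of R)" "b [^] m = a"
proof -
  interpret M: group "mult_of R" by (rule field_mult_group)
  obtain g where g: "g \<in> carrier (mult_of R)" "carrier (mult_of R) = {g [^] i | i::nat. i \<in> UNIV}"
    using finite_field_mult_group_has_gen fin by blast
  have ordg: "M.ord g = order R - 1"
  proof -
    have ord0: "M.ord g \<noteq> 0" using M.ord_ge_1[OF finite_mult_of[OF fin] g(1)] by simp
    have "generate (mult_of R) {g} = carrier (mult_of R)"
      by (simp only: g(2) M.generate_pow_nat[OF g(1) ord0] nat_pow_mult_of)
    then have "order (mult_of R) = M.ord g"
      unfolding order_def using M.generate_pow_card[OF g(1)] by simp
    then show ?thesis using fin by (simp add: order_mult_of)
  qed
  obtain k :: nat where k: "a = g [^] k" using a(1) g(2) by auto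
  have "g [^] (k * e) = \<one>" using a k g by (simp add: nat_pow_pow)
  then have "order R - 1 dvd k * e"
    using M.pow_eq_id[OF g(1), of "k * e"] ordg by (simp add: nat_pow_mult_of)
  then have "e * m dvd e * k" using e(2) dvd_trans by (metis mult.commute)
  then have "m dvd k" using e(1) by simp
  then obtain l where l: "k = l * m" by (metis dvd_def mult.commute)
  show ?thesis
  proof
    show "g [^] l \<in> carrier (mult_of R)"
      using M.nat_pow_closed[OF g(1)] by (simp add: nat_pow_mult_of)
    show "(g [^] l) [^] m = a" using g k l by (simp add: nat_pow_pow)
  qed
qed

text \<open>The powers of \<open>a\<close> already give as many distinct solutions of the equation
  as its degree, and a field admits no more.\<close>

lemma (in field) root_of_unity_eq_power:
  assumes fin: "finite (carrier R)" and a: "a \<in> carrier (mult_of R)"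
    and x: "x \<in> carrier R" "x [^] group.ord (mult_of R) a = \<one>"
  obtains k where "x = a [^] (k :: nat)"
proof -
  interpret M: group "mult_of R" by (rule field_mult_group)
  have pos: "M.ord a > 0" using M.ord_ge_1[OF _ a] fin by simp
  define A where "A = {x \<in> carrier R. x [^] M.ord a = \<one>}"
  have "inj_on (\<lambda>k. a [^] k) {..<M.ord a}"
  proof -
    have "{..<M.ord a} = {0..M.ord a - 1}" using pos by auto
    then show ?thesis using M.ord_inj[OF a] by (simp add: nat_pow_mult_of)
  qed
  then have "card ((\<lambda>k. a [^] k) ` {..<M.ord a}) = M.ord a" by (simp add: card_image)
  moreover have "card A \<le> M.ord a"
    unfolding A_def by (rule num_roots_le_deg) (use fin pos in auto)
  moreover have "(\<lambda>k. a [^] k) ` {..<M.ord a} \<subseteq> A"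
  proof -
    have "a [^] (M.ord a * k) = \<one>" for k
      using M.pow_eq_id[OF a] by (simp add: nat_pow_mult_of)
    then show ?thesis
      using a by (auto simp: A_def nat_pow_pow mult.commute)
  qed
  moreover have "finite A" using fin by (simp add: A_def)
  ultimately have "(\<lambda>k. a [^] k) ` {..<M.ord a} = A" by (intro card_seteq) auto
  moreover have "x \<in> A" using x by (simp add: A_def)
  ultimately show ?thesis using that by auto
qed

section \<open>Powers of a ring and evaluation on the radical extension\<close>

lemma RDirProd_list_hom:
  assumes "\<And>f. f \<in> set fs \<Longrightarrow> f \<in> ring_hom A S"
  shows "(\<lambda>x. map (\<lambda>f. f x) fs) \<in> ring_hom A (RDirProd_list (replicate (length fs) S))"
  using assms
proof (induction fs)
  case Nil
  then show ?case by (auto intro!: ring_hom_memI simp: monoid.defs)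
next
  case (Cons f fs)
  let ?P = "RDirProd_list (replicate (length fs) S)"
  \<comment> \<open>Pairing lands in the binary product; \<open>RDirProd_list_hom1\<close> then
    turns the pair into a list.\<close>
  have "(\<lambda>x. (f x, map (\<lambda>f. f x) fs)) \<in> ring_hom A (RDirProd S ?P)"
    using Cons by (auto simp: ring_hom_def RDirProd_def DirProd_def monoid.defs)
  from ring_hom_trans[OF this RDirProd_list_hom1] show ?case
    by (simp add: comp_def)
qed

text \<open>Puts the carrier into the form counted by \<open>card_lists_length_eq\<close>.\<close>

lemma carrier_RDirProd_list_replicate:
  "carrier (RDirProd_list (replicate n S)) = {xs. set xs \<subseteq> carrier S \<and> length xs = n}"
proof (intro equalityI subsetI)
  fix xs assume "xs \<in> carrier (RDirProd_list (replicate n S))"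
  then show "xs \<in> {xs. set xs \<subseteq> carrier S \<and> length xs = n}"
    using RDirProd_list_carrier_mem[of xs "replicate n S"] by (auto simp: in_set_conv_nth)
qed (auto intro!: RDirProd_list_carrier_memI simp: subset_iff)

text \<open>Serves to multiply two evaluations, whose index pairs are then grouped by
  \<open>(i + j) mod m\<close>.\<close>

lemma (in semiring) finsum_mult_Times:
  assumes "finite A" "finite B" "f \<in> A \<rightarrow> carrier R" "g \<in> B \<rightarrow> carrier R"
  shows "(\<Oplus>i\<in>A. f i) \<otimes> (\<Oplus>j\<in>B. g j) = finsum R (\<lambda>(i, j). f i \<otimes> g j) (A \<times> B)"
  using assms(1,3)
proof (induction A)
  case (insert a A)
  have "insert a A \<times> B = Pair a ` B \<union> A \<times> B" by auto
  moreover have "finsum R (\<lambda>(i, j). f i \<otimes> g j) (Pair a ` B \<union> A \<times> B)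
      = finsum R (\<lambda>(i, j). f i \<otimes> g j) (Pair a ` B) \<oplus> finsum R (\<lambda>(i, j). f i \<otimes> g j) (A \<times> B)"
    by (rule add.finprod_Un_disjoint) (use insert assms in auto)
  moreover have "finsum R (\<lambda>(i, j). f i \<otimes> g j) (Pair a ` B) = (\<Oplus>j\<in>B. f a \<otimes> g j)"
    by (subst add.finprod_reindex) (use insert assms in \<open>auto simp: inj_on_def\<close>)
  moreover have "(\<Oplus>j\<in>B. f a \<otimes> g j) = f a \<otimes> (\<Oplus>j\<in>B. g j)"
    using insert assms by (subst finsum_rdistr) auto
  ultimately show ?case
    using insert assms by (simp add: l_distr finsum_closed Pi_def)
qed (use assms in simp)

text \<open>The formal root is replaced by \<open>b\<close>. The relation
  \<open>b [^] m = h r\<close> is not built in; it enters in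
  \<open>radical_eval_hom\<close>.\<close>

definition radical_eval :: "('b, 'd) ring_scheme \<Rightarrow> ('a \<Rightarrow> 'b) \<Rightarrow> nat \<Rightarrow> 'b \<Rightarrow> (nat \<Rightarrow> 'a) \<Rightarrow> 'b" where
  "radical_eval S h m b x = (\<Oplus>\<^bsub>S\<^esub>j\<in>{..<m}. h (x j) \<otimes>\<^bsub>S\<^esub> b [^]\<^bsub>S\<^esub> j)"

text \<open>Because \<open>b [^] m = h r\<close>, division of \<open>i + j\<close> by
  \<open>m\<close> splits \<open>b [^] (i + j)\<close> exactly as the multiplication of the radical
  extension prescribes.\<close>

lemma (in ring_hom_cring) radical_eval_hom:
  assumes r: "r \<in> carrier R" and b: "b \<in> carrier S" "b [^]\<^bsub>S\<^esub> m = h r" and m: "m > 0"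
  shows "radical_eval S h m b \<in> ring_hom (radical_extension R m r) S"
proof (rule ring_hom_memI)
  fix x assume "x \<in> carrier (radical_extension R m r)"
  then have x: "x j \<in> carrier R" if "j < m" for j
    using that by (auto simp: radical_extension_def)
  then show "radical_eval S h m b x \<in> carrier S"
    using b by (auto simp: radical_eval_def)
  fix y assume "y \<in> carrier (radical_extension R m r)"
  then have y: "y j \<in> carrier R" if "j < m" for j
    using that by (auto simp: radical_extension_def)
  show "radical_eval S h m b (x \<oplus>\<^bsub>radical_extension R m r\<^esub> y)
    = radical_eval S h m b x \<oplus>\<^bsub>S\<^esub> radical_eval S h m b y"
  proof -
    have "radical_eval S h m b (x \<oplus>\<^bsub>radical_extension R m r\<^esub> y)
      = (\<Oplus>\<^bsub>S\<^esub>j\<in>{..<m}. h (x j) \<otimes>\<^bsub>S\<^esub> b [^]\<^bsub>S\<^esub> j \<oplus>\<^bsub>S\<^esub> h (y j) \<otimes>\<^bsub>S\<^esub> b [^]\<^bsub>S\<^esub> j)"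
      unfolding radical_eval_def radical_extension_def
      by (rule S.finsum_cong') (use x y b in \<open>auto simp: S.l_distr\<close>)
    also have "\<dots> = radical_eval S h m b x \<oplus>\<^bsub>S\<^esub> radical_eval S h m b y"
      unfolding radical_eval_def by (rule S.finsum_addf) (use x y b in auto)
    finally show ?thesis .
  qed
  \<comment> \<open>For \<open>k < m\<close> these fibres partition the square of index pairs, which
    regroups the full double sum of the \<open>T p\<close> by output coefficient.\<close>
  define I where "I k = {(i, j). i < m \<and> j < m \<and> (i + j) mod m = k}" for k
  define T where "T = (\<lambda>(i, j). (h (x i) \<otimes>\<^bsub>S\<^esub> b [^]\<^bsub>S\<^esub> i) \<otimes>\<^bsub>S\<^esub> (h (y j) \<otimes>\<^bsub>S\<^esub> b [^]\<^bsub>S\<^esub> j))"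
  have finI: "finite (I k)" for k
    by (rule finite_subset[of _ "{..<m} \<times> {..<m}"]) (auto simp: I_def)
  have T: "h (x i \<otimes> y j \<otimes> r [^] ((i + j) div m)) \<otimes>\<^bsub>S\<^esub> b [^]\<^bsub>S\<^esub> k = T (i, j)"
    if "(i, j) \<in> I k" for i j k
  proof -
    have ij: "i < m" "j < m" "(i + j) mod m = k" using that by (auto simp: I_def)
    have "b [^]\<^bsub>S\<^esub> i \<otimes>\<^bsub>S\<^esub> b [^]\<^bsub>S\<^esub> j = b [^]\<^bsub>S\<^esub> (m * ((i + j) div m) + k)"
      using b mult_div_mod_eq[of m "i + j"] ij(3) by (simp only: S.nat_pow_mult)
    also have "\<dots> = h (r [^] ((i + j) div m)) \<otimes>\<^bsub>S\<^esub> b [^]\<^bsub>S\<^esub> k"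
      using b r by (simp add: S.nat_pow_mult[symmetric] S.nat_pow_pow[symmetric])
    finally have bb: "b [^]\<^bsub>S\<^esub> i \<otimes>\<^bsub>S\<^esub> b [^]\<^bsub>S\<^esub> j = h (r [^] ((i + j) div m)) \<otimes>\<^bsub>S\<^esub> b [^]\<^bsub>S\<^esub> k" .
    have "T (i, j) = h (x i) \<otimes>\<^bsub>S\<^esub> h (y j) \<otimes>\<^bsub>S\<^esub> (b [^]\<^bsub>S\<^esub> i \<otimes>\<^bsub>S\<^esub> b [^]\<^bsub>S\<^esub> j)"
      using x[OF ij(1)] y[OF ij(2)] b by (simp add: T_def S.m_ac)
    then show ?thesis
      using x[OF ij(1)] y[OF ij(2)] b r unfolding bb by (simp add: S.m_ac)
  qed
  have TS: "T p \<in> carrier S" if "p \<in> I k" for p k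
    using that x y b by (auto simp: T_def I_def)
  show "radical_eval S h m b (x \<otimes>\<^bsub>radical_extension R m r\<^esub> y)
    = radical_eval S h m b x \<otimes>\<^bsub>S\<^esub> radical_eval S h m b y"
  proof -
    have "radical_eval S h m b (x \<otimes>\<^bsub>radical_extension R m r\<^esub> y)
      = (\<Oplus>\<^bsub>S\<^esub>k\<in>{..<m}. \<Oplus>\<^bsub>S\<^esub>p\<in>I k. T p)"
      unfolding radical_eval_def
    proof (rule S.finsum_cong')
      fix k assume k: "k \<in> {..<m}"
      have cl: "(\<lambda>(i, j). x i \<otimes> y j \<otimes> r [^] ((i + j) div m)) \<in> I k \<rightarrow> carrier R"
        using x y r by (auto simp: I_def)
      have "h ((x \<otimes>\<^bsub>radical_extension R m r\<^esub> y) k) \<otimes>\<^bsub>S\<^esub> b [^]\<^bsub>S\<^esub> k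
        = (\<Oplus>\<^bsub>S\<^esub>p\<in>I k. h (case p of (i, j) \<Rightarrow> x i \<otimes> y j \<otimes> r [^] ((i + j) div m))) \<otimes>\<^bsub>S\<^esub> b [^]\<^bsub>S\<^esub> k"
        using k hom_finsum[OF cl] by (simp add: radical_extension_def I_def[symmetric] comp_def)
      also have "\<dots> = (\<Oplus>\<^bsub>S\<^esub>p\<in>I k. h (case p of (i, j) \<Rightarrow> x i \<otimes> y j \<otimes> r [^] ((i + j) div m)) \<otimes>\<^bsub>S\<^esub> b [^]\<^bsub>S\<^esub> k)"
        by (rule S.finsum_ldistr) (use finI cl b in \<open>auto simp: Pi_iff simp del: hom_mult\<close>)
      also have "\<dots> = (\<Oplus>\<^bsub>S\<^esub>p\<in>I k. T p)"
        by (rule S.finsum_cong') (use T TS in auto)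
      finally show "h ((x \<otimes>\<^bsub>radical_extension R m r\<^esub> y) k) \<otimes>\<^bsub>S\<^esub> b [^]\<^bsub>S\<^esub> k = (\<Oplus>\<^bsub>S\<^esub>p\<in>I k. T p)" .
    qed (use TS in \<open>auto intro!: S.finsum_closed\<close>)
    also have "\<dots> = (\<Oplus>\<^bsub>S\<^esub>p\<in>(\<Union>k\<in>{..<m}. I k). T p)"
      by (rule S.add.finprod_UN_disjoint[symmetric])
        (use finI TS in \<open>auto simp: pairwise_def disjnt_def I_def\<close>)
    also have "(\<Union>k\<in>{..<m}. I k) = {..<m} \<times> {..<m}" using m by (auto simp: I_def)
    also have "(\<Oplus>\<^bsub>S\<^esub>p\<in>{..<m} \<times> {..<m}. T p) = radical_eval S h m b x \<otimes>\<^bsub>S\<^esub> radical_eval S h m b y"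
      unfolding radical_eval_def T_def by (rule S.finsum_mult_Times[symmetric]) (use x y b in auto)
    finally show ?thesis .
  qed
next
  have "radical_eval S h m b \<one>\<^bsub>radical_extension R m r\<^esub>
    = (\<Oplus>\<^bsub>S\<^esub>j\<in>{0::nat}. \<one>\<^bsub>S\<^esub>)"
    unfolding radical_eval_def radical_extension_def
    by (rule S.add.finprod_mono_neutral_cong_right) (use m b in auto)
  then show "radical_eval S h m b \<one>\<^bsub>radical_extension R m r\<^esub> = \<one>\<^bsub>S\<^esub>" by simp
qed

text \<open>The \<open>order F\<close>-th power map is additive on \<open>K\<close> and fixes the
  image of \<open>F\<close>, so it passes through the sum and the coefficients and acts on
  \<open>b\<close> alone.\<close>

lemma radical_eval_frobenius:
  assumes F: "field F" "finite (carrier F)" and K: "field K" and \<phi>: "\<phi> \<in> ring_hom F K"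
    and b: "b \<in> carrier K" and x: "\<And>j. j < m \<Longrightarrow> x j \<in> carrier F"
  shows "radical_eval K \<phi> m b x [^]\<^bsub>K\<^esub> order F = radical_eval K \<phi> m (b [^]\<^bsub>K\<^esub> order F) x"
proof -
  interpret F: field F by fact
  interpret K: field K by fact
  interpret \<phi>: ring_hom_ring F K \<phi>
    by (simp add: ring_hom_ring_def ring_hom_ring_axioms_def F.ring_axioms K.ring_axioms \<phi>)
  have q0: "order F > 0" using F by (simp add: F.order_gt_0_iff_finite)
  have sum: "(\<Oplus>\<^bsub>K\<^esub>j\<in>A. f j) [^]\<^bsub>K\<^esub> order F = (\<Oplus>\<^bsub>K\<^esub>j\<in>A. f j [^]\<^bsub>K\<^esub> order F)"
    if "finite A" "f \<in> A \<rightarrow> carrier K" for f and A :: "nat set"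
    using that
  proof (induction A)
    case (insert a A)
    then show ?case
      by (simp add: finite_field_frobenius_add[OF F K \<phi>] K.finsum_closed Pi_def)
  qed (use q0 in \<open>simp add: K.nat_pow_zero\<close>)
  have "radical_eval K \<phi> m b x [^]\<^bsub>K\<^esub> order F
      = (\<Oplus>\<^bsub>K\<^esub>j\<in>{..<m}. (\<phi> (x j) \<otimes>\<^bsub>K\<^esub> b [^]\<^bsub>K\<^esub> j) [^]\<^bsub>K\<^esub> order F)"
    unfolding radical_eval_def by (rule sum) (use x b in auto)
  also have "\<dots> = (\<Oplus>\<^bsub>K\<^esub>j\<in>{..<m}. \<phi> (x j) \<otimes>\<^bsub>K\<^esub> (b [^]\<^bsub>K\<^esub> order F) [^]\<^bsub>K\<^esub> j)"
  proof (rule K.finsum_cong')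
    fix j assume "j \<in> {..<m}"
    then have xj: "x j \<in> carrier F" using x by simp
    have "\<phi> (x j) [^]\<^bsub>K\<^esub> order F = \<phi> (x j)"
      using F xj by (simp add: \<phi>.hom_nat_pow[symmetric] F.pow_order_eq_self)
    then show "(\<phi> (x j) \<otimes>\<^bsub>K\<^esub> b [^]\<^bsub>K\<^esub> j) [^]\<^bsub>K\<^esub> order F
        = \<phi> (x j) \<otimes>\<^bsub>K\<^esub> (b [^]\<^bsub>K\<^esub> order F) [^]\<^bsub>K\<^esub> j"
      using b xj by (simp add: K.nat_pow_distrib K.nat_pow_pow mult.commute)
  qed (use x b in auto)
  finally show ?thesis by (simp add: radical_eval_def)
qed

section \<open>The isomorphism\<close>

theorem corollary8:
  fixes F :: "('a, 'c) ring_scheme" and K :: "('b, 'd) ring_scheme"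
    and m t :: nat and r :: 'a
  assumes "field F" and "finite (carrier F)"
    and "m > 0"
    and "r \<in> carrier (Multiplicative_Group.mult_of F)"
    and "\<exists>z \<in> carrier (Multiplicative_Group.mult_of F).
           group.ord (Multiplicative_Group.mult_of F) z = m"
    and "t = (LEAST s. 0 < s \<and>
           group.ord (Multiplicative_Group.mult_of F) r * m dvd order F ^ s - 1)"
    and "field K" and "order K = order F ^ t"
  shows "t dvd m \<and>
    radical_extension F m r \<simeq> RDirProd_list (replicate (m div t) K)"
proof -
  note F = assms(1,2) and m = assms(3) and r = assms(4) and K = assms(7) and orderK = assms(8)
  obtain z where z: "z \<in> carrier (mult_of F)" "group.ord (mult_of F) z = m"
    using assms(5) by blast
  interpret F: field F by fact
  interpret K: field K by fact
  interpret M: group "mult_of F" by (rule F.field_mult_group)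
  define q where "q = order F"
  have q0: "q > 0" using F by (simp add: F.order_gt_0_iff_finite q_def)
  have finM: "finite (carrier (mult_of F))" using F by simp
  have mq: "m dvd order F - 1"
    using M.ord_dvd_group_order[OF z(1)] z(2) F by (simp add: F.order_mult_of)
  define \<eta> where "\<eta> = r [^]\<^bsub>F\<^esub> ((order F - 1) div m)"
  have \<eta>: "\<eta> \<in> carrier (mult_of F)"
    using M.nat_pow_closed[OF r] by (simp add: \<eta>_def nat_pow_mult_of)
  have dvd_iff: "M.ord r * m dvd order F ^ s - 1 \<longleftrightarrow> M.ord \<eta> dvd s" for s
    using F.ord_mult_dvd_power_diff_one_iff[OF F(2) mq m r] by (simp only: \<eta>_def)
  have ord\<eta>: "M.ord \<eta> > 0" using M.ord_ge_1[OF finM \<eta>] by simp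
  \<comment> \<open>For positive \<open>s\<close> the divisibility now reads
    \<open>M.ord \<eta> dvd s\<close>, whose least solution is \<open>M.ord \<eta>\<close>
    itself.\<close>
  have t: "t = M.ord \<eta>"
    unfolding assms(6) dvd_iff using ord\<eta> by (intro Least_equality) (auto intro: dvd_imp_le)
  have t0: "t > 0" using ord\<eta> t by simp
  have powF: "x [^]\<^bsub>mult_of F\<^esub> k = x [^]\<^bsub>F\<^esub> k" for x and k :: nat
    by (simp add: nat_pow_mult_of)
  have rF: "r \<in> carrier F" and zF: "z \<in> carrier F" and \<eta>F: "\<eta> \<in> carrier F"
    using r z \<eta> by auto
  have "r [^]\<^bsub>F\<^esub> (order F - 1) = \<one>\<^bsub>F\<^esub>"
    using M.pow_order_eq_1[OF r] F by (simp add: powF F.order_mult_of)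
  then have \<eta>m: "\<eta> [^]\<^bsub>F\<^esub> m = \<one>\<^bsub>F\<^esub>"
    using mq rF by (simp add: \<eta>_def F.nat_pow_pow)
  then have tm: "t dvd m"
    unfolding t using M.pow_eq_id[OF \<eta>] by (simp add: powF)
  have zm: "z [^]\<^bsub>F\<^esub> m = \<one>\<^bsub>F\<^esub>"
    using M.pow_ord_eq_1[OF z(1)] z(2) by (simp add: powF)

  obtain \<phi> where \<phi>: "\<phi> \<in> ring_hom F K"
    using finite_field_embedding[OF F K orderK t0] by blast
  interpret H: ring_hom_cring F K \<phi>
    by (simp add: ring_hom_cring_def ring_hom_cring_axioms_def F.is_cring K.is_cring \<phi>)
  have rhr: "ring_hom_ring F K \<phi>"
    by (simp add: ring_hom_ring_def ring_hom_ring_axioms_def F.ring_axioms K.ring_axioms \<phi>)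
  have inj: "inj_on \<phi> (carrier F)"
  proof (rule ring_hom_ring.non_trivial_field_hom_imp_inj[OF rhr F(1)])
    have "\<one>\<^bsub>K\<^esub> \<in> \<phi> ` carrier F" by (metis F.one_closed H.hom_one imageI)
    then show "\<phi> ` carrier F \<noteq> {\<zero>\<^bsub>K\<^esub>}" by (metis K.one_not_zero singletonD)
  qed
  have pow: "\<phi> (x [^]\<^bsub>F\<^esub> k) = \<phi> x [^]\<^bsub>K\<^esub> k" if "x \<in> carrier F" for x and k :: nat
    using that by (rule ring_hom_ring.hom_nat_pow[OF rhr])
  have finK: "finite (carrier K)"
    using orderK q0 K.order_gt_0_iff_finite by (simp add: q_def)

  define e where "e = M.ord r"
  have e0: "e > 0" using M.ord_ge_1[OF finM r] by (simp add: e_def)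
  have em: "e * m dvd order K - 1" using dvd_iff[of t] by (simp add: orderK e_def t)
  have \<phi>0: "\<phi> x \<noteq> \<zero>\<^bsub>K\<^esub>" if "x \<in> carrier (mult_of F)" for x
    using that inj_onD[OF inj, of x "\<zero>\<^bsub>F\<^esub>"] by auto
  have \<phi>r: "\<phi> r \<in> carrier (mult_of K)" using \<phi>0[OF r] rF by simp
  have "\<phi> r [^]\<^bsub>K\<^esub> e = \<one>\<^bsub>K\<^esub>"
    using M.pow_ord_eq_1[OF r] rF by (simp add: pow[symmetric] e_def powF)
  from K.exists_root[OF finK \<phi>r this e0 em]
  obtain \<beta> where \<beta>: "\<beta> \<in> carrier (mult_of K)" "\<beta> [^]\<^bsub>K\<^esub> m = \<phi> r" by blast
  have \<beta>K: "\<beta> \<in> carrier K" using \<beta> by simp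

  \<comment> \<open>The indices \<open>i < m\<close> give all \<open>m\<close> roots of
    \<open>\<phi> r\<close>; only those below \<open>n\<close> enter \<open>\<Psi>\<close>.\<close>
  define b where "b i = \<beta> \<otimes>\<^bsub>K\<^esub> \<phi> (z [^]\<^bsub>F\<^esub> i)" for i :: nat
  have bK: "b i \<in> carrier K" for i using \<beta>K zF by (simp add: b_def)
  have bm: "b i [^]\<^bsub>K\<^esub> m = \<phi> r" for i
  proof -
    have "(z [^]\<^bsub>F\<^esub> i) [^]\<^bsub>F\<^esub> m = \<one>\<^bsub>F\<^esub>"
      using zF zm by (metis F.nat_pow_pow F.nat_pow_one mult.commute)
    then show ?thesis
      using \<beta> zF rF by (simp add: b_def K.nat_pow_distrib pow[symmetric] del: H.hom_pow)
  qed
  define n where "n = m div t"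
  define \<Psi> where "\<Psi> x = map (\<lambda>i. radical_eval K \<phi> m (b i) x) [0..<n]" for x
  let ?A = "radical_extension F m r" and ?P = "RDirProd_list (replicate n K)"
  have hom: "\<Psi> \<in> ring_hom ?A ?P"
    using RDirProd_list_hom[of "map (\<lambda>i. radical_eval K \<phi> m (b i)) [0..<n]" ?A K]
      H.radical_eval_hom[OF rF bK bm m]
    by (auto simp: \<Psi>_def[abs_def] comp_def)

  \<comment> \<open>A zero at an \<open>m\<close>-th root \<open>c\<close> of
    \<open>\<phi> r\<close> spreads along its Frobenius orbit, which consists of the multiples of
    \<open>c\<close> by the images of powers of \<open>\<eta>\<close>.\<close>
  have conj: "radical_eval K \<phi> m (c \<otimes>\<^bsub>K\<^esub> \<phi> (\<eta> [^]\<^bsub>F\<^esub> k)) x = \<zero>\<^bsub>K\<^esub>"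
    if x: "\<And>j. j < m \<Longrightarrow> x j \<in> carrier F" and c: "c \<in> carrier K" "c [^]\<^bsub>K\<^esub> m = \<phi> r"
      and zero: "radical_eval K \<phi> m c x = \<zero>\<^bsub>K\<^esub>" for c x and k :: nat
  proof (induction k)
    case 0
    then show ?case using c zero by simp
  next
    case (Suc k)
    define c' where "c' = c \<otimes>\<^bsub>K\<^esub> \<phi> (\<eta> [^]\<^bsub>F\<^esub> k)"
    have c': "c' \<in> carrier K" using c \<eta>F by (simp add: c'_def)
    have "(\<eta> [^]\<^bsub>F\<^esub> k) [^]\<^bsub>F\<^esub> m = \<one>\<^bsub>F\<^esub>"
      using \<eta>F \<eta>m by (metis F.nat_pow_pow F.nat_pow_one mult.commute)
    then have c'm: "c' [^]\<^bsub>K\<^esub> m = \<phi> r"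
      using c \<eta>F rF by (simp add: c'_def K.nat_pow_distrib pow[symmetric] del: H.hom_pow)
    \<comment> \<open>With this exponent and \<open>c' ^ m = \<phi> r\<close>, Frobenius multiplies
      \<open>c'\<close> by \<open>\<phi> \<eta>\<close>.\<close>
    have "order F = m * ((order F - 1) div m) + 1" using mq q0 by (simp add: q_def)
    then have "c' [^]\<^bsub>K\<^esub> order F = c' [^]\<^bsub>K\<^esub> (m * ((order F - 1) div m) + 1)" by (rule arg_cong)
    also have "\<dots> = (c' [^]\<^bsub>K\<^esub> m) [^]\<^bsub>K\<^esub> ((order F - 1) div m) \<otimes>\<^bsub>K\<^esub> c'"
      using c' by (simp add: K.nat_pow_pow)
    also have "\<dots> = \<phi> \<eta> \<otimes>\<^bsub>K\<^esub> c'" unfolding c'm \<eta>_def using rF by (simp add: pow)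
    also have "\<dots> = c \<otimes>\<^bsub>K\<^esub> \<phi> (\<eta> [^]\<^bsub>F\<^esub> Suc k)"
      using c \<eta>F by (simp add: c'_def K.m_ac)
    finally have frob: "c' [^]\<^bsub>K\<^esub> order F = c \<otimes>\<^bsub>K\<^esub> \<phi> (\<eta> [^]\<^bsub>F\<^esub> Suc k)" .
    have "radical_eval K \<phi> m (c' [^]\<^bsub>K\<^esub> order F) x = \<zero>\<^bsub>K\<^esub> [^]\<^bsub>K\<^esub> order F"
      using radical_eval_frobenius[where m = m and x = x, OF F K \<phi> c' x] Suc by (simp add: c'_def)
    then show ?case unfolding frob using q0 by (simp add: K.nat_pow_zero q_def)
  qed

  have inj\<Psi>: "inj_on \<Psi> (carrier ?A)"
  proof (rule inj_onI)
    fix x y assume xA: "x \<in> carrier ?A" and yA: "y \<in> carrier ?A" and eq: "\<Psi> x = \<Psi> y"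
    have x: "x j \<in> carrier F" and y: "y j \<in> carrier F" if "j < m" for j
      using that xA yA by (auto simp: radical_extension_def)
    \<comment> \<open>No ring structure on \<open>?A\<close> is presupposed: the kernel argument
      uses only additivity of the evaluations on \<open>x = w + y\<close>.\<close>
    define w where "w = (\<lambda>j\<in>{..<m}. x j \<ominus>\<^bsub>F\<^esub> y j)"
    have w: "w j \<in> carrier F" if "j < m" for j using x y that by (simp add: w_def)
    have wA: "w \<in> carrier ?A" using x y by (auto simp: radical_extension_def w_def)
    have xw: "x = w \<oplus>\<^bsub>?A\<^esub> y"
    proof
      fix j
      show "x j = (w \<oplus>\<^bsub>?A\<^esub> y) j"
      proof (cases "j < m")
        case True
        then show ?thesis
          using x y by (simp add: radical_extension_def w_def a_minus_def F.a_assoc F.l_neg)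
      next
        case False
        then show ?thesis
          using xA PiE_arb[of x "{..<m}" _ j] by (simp add: radical_extension_def)
      qed
    qed
    have wz: "radical_eval K \<phi> m (b i) w = \<zero>\<^bsub>K\<^esub>" if i: "i < n" for i
    proof -
      note evh = H.radical_eval_hom[OF rF bK bm m, of i]
      have "radical_eval K \<phi> m (b i) w \<oplus>\<^bsub>K\<^esub> radical_eval K \<phi> m (b i) y
          = radical_eval K \<phi> m (b i) y"
        using eq i ring_hom_add[OF evh wA yA] xw by (simp add: \<Psi>_def)
      then show ?thesis
        using ring_hom_closed[OF evh wA] ring_hom_closed[OF evh yA]
        by (simp only: K.add.r_cancel_one)
    qed
    have all: "radical_eval K \<phi> m (b j) w = \<zero>\<^bsub>K\<^esub>" for j
    proof -
      \<comment> \<open>Split \<open>j\<close> into \<open>j mod n\<close> and a multiple of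
        \<open>n\<close>. As \<open>n * t = m\<close>, the factor \<open>a\<close> satisfies
        \<open>a ^ t = 1\<close>, so it is a power of \<open>\<eta>\<close>, and \<open>conj\<close>
        carries the zero from \<open>b (j mod n)\<close> to \<open>b j\<close>.\<close>
      define a where "a = z [^]\<^bsub>F\<^esub> (n * (j div n))"
      have n0: "n > 0" using tm m t0 by (auto simp: n_def dvd_imp_le div_greater_zero_iff)
      have aF: "a \<in> carrier F" using zF by (simp add: a_def)
      have nt: "n * (j div n) * t = m * (j div n)" using tm by (simp add: n_def)
      have "a [^]\<^bsub>F\<^esub> t = (z [^]\<^bsub>F\<^esub> m) [^]\<^bsub>F\<^esub> (j div n)"
        using zF by (simp only: a_def F.nat_pow_pow nt)
      then have "a [^]\<^bsub>F\<^esub> M.ord \<eta> = \<one>\<^bsub>F\<^esub>" by (simp add: zm t)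
      from F.root_of_unity_eq_power[OF F(2) \<eta> aF this] obtain k :: nat where k: "a = \<eta> [^]\<^bsub>F\<^esub> k" .
      have "z [^]\<^bsub>F\<^esub> j = z [^]\<^bsub>F\<^esub> (j mod n) \<otimes>\<^bsub>F\<^esub> a"
        using zF by (simp add: a_def F.nat_pow_mult)
      then have "b j = b (j mod n) \<otimes>\<^bsub>K\<^esub> \<phi> (\<eta> [^]\<^bsub>F\<^esub> k)"
        using zF \<beta>K aF by (simp add: b_def k[symmetric] K.m_assoc)
      then show ?thesis
        using conj[where x = w, OF w bK bm wz, of "j mod n" k] n0 by simp
    qed
    \<comment> \<open>\<open>\<phi>\<close> is injective and \<open>z\<close> has order
      \<open>m\<close>, so \<open>w\<close> has \<open>m\<close> distinct roots, more than its
      degree allows unless it is zero.\<close>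
    have binj: "inj_on b {..<m}"
    proof (rule inj_onI)
      fix i j assume ij: "i \<in> {..<m}" "j \<in> {..<m}" "b i = b j"
      have "\<phi> (z [^]\<^bsub>F\<^esub> i) = \<phi> (z [^]\<^bsub>F\<^esub> j)"
        using ij(3) \<beta> zF K.m_lcancel[of \<beta>] by (simp add: b_def)
      then have "z [^]\<^bsub>F\<^esub> i = z [^]\<^bsub>F\<^esub> j" using inj_onD[OF inj] zF by simp
      then show "i = j"
        using inj_onD[OF M.ord_inj[OF z(1)], of i j] ij z(2) by (auto simp: powF)
    qed
    have "\<phi> (w j) = \<zero>\<^bsub>K\<^esub>" if "j < m" for j
    proof (rule K.many_roots_imp_coeffs_zero[of _ m "b ` {..<m}"])
      show "(\<Oplus>\<^bsub>K\<^esub>i\<in>{..<m}. \<phi> (w i) \<otimes>\<^bsub>K\<^esub> c [^]\<^bsub>K\<^esub> i) = \<zero>\<^bsub>K\<^esub>" if "c \<in> b ` {..<m}" for c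
        using that all by (auto simp: radical_eval_def)
    qed (use finK w bK binj that in \<open>auto simp: card_image\<close>)
    then have "w j = \<zero>\<^bsub>F\<^esub>" if "j < m" for j
      using that w inj_onD[OF inj, of "w j" "\<zero>\<^bsub>F\<^esub>"] by simp
    then have "x j = y j" if "j < m" for j
      using that x y by (simp add: w_def)
    then show "x = y"
      using xA yA by (auto simp: radical_extension_def intro: PiE_ext)
  qed
  have \<Psi>sub: "\<Psi> ` carrier ?A \<subseteq> carrier ?P"
    using ring_hom_closed[OF hom] by blast
  \<comment> \<open>Surjectivity follows by counting, since
    \<open>(q^t)^(m/t) = q^m\<close>.\<close>
  have "card (carrier ?A) = order F ^ m"
    by (simp add: radical_extension_def card_PiE order_def)
  moreover have "card (carrier ?P) = order K ^ n"
    unfolding carrier_RDirProd_list_replicate order_def by (rule card_lists_length_eq[OF finK])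
  moreover have "order K ^ n = order F ^ m"
    using tm by (simp add: orderK n_def power_mult[symmetric])
  ultimately have "card (\<Psi> ` carrier ?A) = card (carrier ?P)"
    using card_image[OF inj\<Psi>] by simp
  moreover have "finite (carrier ?P)"
    unfolding carrier_RDirProd_list_replicate by (rule finite_lists_length_eq[OF finK])
  ultimately have "\<Psi> ` carrier ?A = carrier ?P"
    using \<Psi>sub by (intro card_subset_eq)
  then have "\<Psi> \<in> ring_iso ?A ?P"
    using hom inj\<Psi> by (simp add: ring_iso_def bij_betw_def)
  then have "?A \<simeq> ?P" by (auto simp: is_ring_iso_def)
  then show ?thesis using tm by (simp add: n_def)
qed

end
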